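(* Let $G$ be a connected graph with $n$ vertices and minimum degree $\delta$, and let $k$ be an integer with $2\le k\le n$. Then $$rx_k(G)<\frac{10nk2^t}{\delta-2^{t+1}+2}-k-2,$$ where $t$ is the integer such that $2^t\leq k<2^{t+1}$.
   Context: All graphs are simple, finite and undirected. For an edge-coloring of a connected graph $G$ (adjacent edges may receive the same color), a tree in $G$ is a rainbow tree if no two of its edges receive the same color. For an integer $k$ with $2\leq k\leq n=|V(G)|$, an edge-coloring is a $k$-rainbow coloring if for every set $S$ of $k$ vertices of $G$ there is a rainbow tree in $G$ containing all vertices of $S$. The $k$-rainbow index $rx_k(G)$ is the minimum number of colors in a $k$-rainbow coloring of $G$.
   Formalization: The formal theorem also assumes δ − 2^{t+1} + 2 > 0; otherwise the bound is undefined (denominator 0) or negative and hence false, e.g. G = K_2, k = 2, t = 1, δ = 1 gives the bound −84. *)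

theory Defs
  imports Complex_Main
begin

definition simple_graph :: "'a set \<Rightarrow> 'a set set \<Rightarrow> bool" where
  "simple_graph V E \<longleftrightarrow> finite V \<and> (\<forall>e\<in>E. e \<subseteq> V \<and> card e = 2)"

definition adjacency :: "'a set set \<Rightarrow> ('a \<times> 'a) set" where
  "adjacency E = {(u, v). {u, v} \<in> E}"

(* The graph without vertices does not count as connected, so trees are nonempty. *)
definition connected_graph :: "'a set \<Rightarrow> 'a set set \<Rightarrow> bool" where
  "connected_graph V E \<longleftrightarrow>
     simple_graph V E \<and> V \<noteq> {} \<and> (\<forall>u\<in>V. \<forall>v\<in>V. (u, v) \<in> (adjacency E)\<^sup>*)"

definition is_cycle :: "'a set set \<Rightarrow> 'a list \<Rightarrow> bool" where
  "is_cycle E vs \<longleftrightarrow> length vs \<ge> 3 \<and> distinct vs \<and>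
     (\<forall>i<length vs. {vs ! i, vs ! (Suc i mod length vs)} \<in> E)"

definition is_tree :: "'a set \<Rightarrow> 'a set set \<Rightarrow> bool" where
  "is_tree V E \<longleftrightarrow> connected_graph V E \<and> (\<nexists>vs. is_cycle E vs)"

definition vertex_degree :: "'a set set \<Rightarrow> 'a \<Rightarrow> nat" where
  "vertex_degree E v = card {e \<in> E. v \<in> e}"

definition min_degree :: "'a set \<Rightarrow> 'a set set \<Rightarrow> nat" where
  "min_degree V E = Min (vertex_degree E ` V)"

definition rainbow_tree_in ::
  "'a set \<Rightarrow> 'a set set \<Rightarrow> ('a set \<Rightarrow> nat) \<Rightarrow> 'a set \<Rightarrow> 'a set set \<Rightarrow> bool" where
  "rainbow_tree_in V E c W F \<longleftrightarrow> W \<subseteq> V \<and> F \<subseteq> E \<and> is_tree W F \<and> inj_on c F"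

definition k_rainbow_coloring ::
  "nat \<Rightarrow> 'a set \<Rightarrow> 'a set set \<Rightarrow> ('a set \<Rightarrow> nat) \<Rightarrow> bool" where
  "k_rainbow_coloring k V E c \<longleftrightarrow>
     (\<forall>S. S \<subseteq> V \<and> card S = k \<longrightarrow> (\<exists>W F. rainbow_tree_in V E c W F \<and> S \<subseteq> W))"

(* An edge-coloring is a function on all sets, of which only the values on E matter; card (c ` E)
   counts the colors used. The minimum is attained whenever (V, E) is connected, since an injective
   coloring makes a spanning tree rainbow. *)
definition rainbow_index :: "nat \<Rightarrow> 'a set \<Rightarrow> 'a set set \<Rightarrow> nat" where
  "rainbow_index k V E = (LEAST m. \<exists>c. k_rainbow_coloring k V E c \<and> card (c ` E) = m)"

end

(* Orient G so that every vertex v has out-degree at least (deg v - 1)/2, and split the out-edges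
   of every vertex evenly into k classes. For each class i, a maximal set D_i of vertices with
   pairwise disjoint closed class-i out-neighbourhoods has at most 2kn/(\<delta>+1) elements, and from
   every vertex there is a walk of length at most 2 into D_i using class-i edges only. A connected
   subgraph with at most 3n/(\<delta>+1) - 3 edges that is within distance 2 of every vertex extends to a
   connected subgraph (S, T) containing all D_i with at most (3 + 4k^2)n/(\<delta>+1) - 3 edges. Give the
   edges of T distinct colours, and every other edge one of two colours per class, according to
   whether its tail lies in D_i. The i-th of k given vertices reaches S along class i, so T with
   these k legs is connected and rainbow. This uses |T| + 2k colours; as 2^(t+1) > k, that is below
   the asserted bound. *)

theory Submission
  imports Defs
begin

section \<open>Adjacency, connectedness and spanning trees\<close>

lemma adjacency_iff [simp]: "(u, v) \<in> adjacency E \<longleftrightarrow> {u, v} \<in> E"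
  by (simp add: adjacency_def)

lemma sym_adjacency: "sym (adjacency E)"
  by (auto simp: sym_def insert_commute)

lemma adjacency_in_vertices:
  assumes "simple_graph V E" "{u, v} \<in> E"
  shows "u \<in> V" "v \<in> V" "u \<noteq> v"
  using assms unfolding simple_graph_def by (auto dest!: bspec)

lemma simple_graph_no_loop: "simple_graph V E \<Longrightarrow> (v, v) \<notin> adjacency E"
  using adjacency_in_vertices(3)[of V E v v] by auto

lemma simple_graph_finite_edges: "simple_graph V E \<Longrightarrow> finite E"
  unfolding simple_graph_def by (rule finite_subset[of _ "Pow V"]) auto

text \<open>Every step across the deleted edge can be replaced by the assumed detour or its reverse,
  so the old adjacency relation lies in the reflexive transitive closure of the new one.\<close>

lemma connected_graph_remove_edge:
  assumes "connected_graph V E" "(u, v) \<in> (adjacency (E - {{u, v}}))\<^sup>*"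
  shows "connected_graph V (E - {{u, v}})"
proof -
  let ?R = "(adjacency (E - {{u, v}}))\<^sup>*"
  have "sym ?R" by (simp add: sym_adjacency sym_rtrancl)
  then have "(v, u) \<in> ?R" using assms(2) by (meson symD)
  have "(a, b) \<in> ?R" if "{a, b} \<in> E" for a b
  proof (cases "{a, b} = {u, v}")
    case True
    then show ?thesis using assms(2) \<open>(v, u) \<in> ?R\<close> by (auto simp: doubleton_eq_iff)
  next
    case False
    then show ?thesis using that by (intro r_into_rtrancl) simp
  qed
  then have "adjacency E \<subseteq> ?R" by auto
  then have "(adjacency E)\<^sup>* \<subseteq> ?R" by (metis rtrancl_idemp rtrancl_mono)
  then show ?thesis using assms(1) unfolding connected_graph_def simple_graph_def by blast
qed

text \<open>A connected spanning subgraph with fewest edges has no cycle, since an edge of a cycle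
  could be deleted. This later turns connected rainbow subgraphs into rainbow trees.\<close>

lemma connected_graph_has_spanning_tree:
  assumes "connected_graph V E"
  shows "\<exists>F\<subseteq>E. is_tree V F"
proof -
  have "finite E"
    using assms simple_graph_finite_edges unfolding connected_graph_def by blast
  have "\<exists>F. (F \<subseteq> E \<and> connected_graph V F) \<and>
      (\<forall>F'. F' \<subseteq> E \<and> connected_graph V F' \<longrightarrow> card F \<le> card F')"
    by (rule ex_has_least_nat[of _ E]) (simp add: assms)
  then obtain F where F: "F \<subseteq> E" "connected_graph V F"
    and least: "\<And>F'. F' \<subseteq> E \<Longrightarrow> connected_graph V F' \<Longrightarrow> card F \<le> card F'"
    by blast
  have "finite F" using F(1) \<open>finite E\<close> by (rule finite_subset)
  have "\<not> is_cycle F vs" for vs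
  proof
    assume cyc: "is_cycle F vs"
    define m where "m = length vs - 1"
    have len: "length vs = Suc m" "m \<ge> 2" and "distinct vs"
      and step: "\<And>i. i < length vs \<Longrightarrow> {vs ! i, vs ! (Suc i mod length vs)} \<in> F"
      using cyc unfolding is_cycle_def m_def by auto
    \<comment> \<open>The closing edge of the cycle; the rest of the cycle is the detour between its
      ends.\<close>
    let ?e = "{vs ! 0, vs ! m}"
    have "?e \<in> F" using step[of m] len by (simp add: insert_commute)
    have path: "(vs ! 0, vs ! i) \<in> (adjacency (F - {?e}))\<^sup>*" if "i \<le> m" for i
      using that
    proof (induction i)
      case (Suc i)
      have "{vs ! i, vs ! Suc i} \<in> F" using step[of i] Suc.prems len by simp
      \<comment> \<open>This relies on \<open>m \<ge> 2\<close>: a consecutive pair equal to the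
        closing pair would force \<open>i = 0\<close> and \<open>Suc i = m\<close>.\<close>
      moreover have "{vs ! i, vs ! Suc i} \<noteq> ?e"
        using \<open>distinct vs\<close> Suc.prems len by (auto simp: doubleton_eq_iff nth_eq_iff_index_eq)
      ultimately have "(vs ! i, vs ! Suc i) \<in> adjacency (F - {?e})" by simp
      then show ?case using Suc by (meson Suc_leD rtrancl_into_rtrancl)
    qed simp
    have "card F \<le> card (F - {?e})"
      using F by (intro least connected_graph_remove_edge path) auto
    moreover have "card (F - {?e}) < card F"
      using \<open>finite F\<close> \<open>?e \<in> F\<close> by (rule card_Diff1_less)
    ultimately show False by simp
  qed
  then show ?thesis using F unfolding is_tree_def by blast
qed

text \<open>Covers both a new leaf \<open>y\<close> and an extra edge between old vertices. The
  latter may close a cycle, so trees are extracted only at the very end.\<close>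

lemma connected_graph_insert:
  assumes "connected_graph W F" "x \<in> W" "x \<noteq> y"
  shows "connected_graph (insert y W) (insert {x, y} F)"
proof -
  let ?R = "(adjacency (insert {x, y} F))\<^sup>*"
  have sg: "simple_graph (insert y W) (insert {x, y} F)"
    using assms unfolding connected_graph_def simple_graph_def by auto
  have "sym ?R" by (simp add: sym_adjacency sym_rtrancl)
  have "(adjacency F)\<^sup>* \<subseteq> ?R" by (rule rtrancl_mono) auto
  then have "(x, z) \<in> ?R" if "z \<in> W" for z
    using assms that unfolding connected_graph_def by blast
  moreover have "(x, y) \<in> ?R" by auto
  ultimately have "(x, z) \<in> ?R" if "z \<in> insert y W" for z using that by blast
  then show ?thesis unfolding connected_graph_def using sg \<open>sym ?R\<close>
    by (metis insert_not_empty rtrancl_trans symD)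
qed

section \<open>Balanced orientations of symmetric relations\<close>

lemma card_exchange: "finite X \<Longrightarrow> a \<in> X \<Longrightarrow> b \<notin> X \<Longrightarrow> card (insert b (X - {a})) = card X"
  by (metis Diff_iff card.remove card_insert_disjoint finite_Diff)

text \<open>Splitting off: replace a path \<open>u - v - w\<close> by the edge \<open>u - w\<close> (or drop the triangle
  \<open>u v w\<close>), orient the smaller graph, and reroute through \<open>v\<close>.\<close>

lemma balanced_orientation:
  assumes "finite R" "sym R" "irrefl R"
  shows "\<exists>A\<subseteq>R. A \<inter> A\<inverse> = {} \<and> (\<forall>v. card (R `` {v}) \<le> 2 * card (A `` {v}) + 1)"
  using assms
proof (induction "card R" arbitrary: R rule: less_induct)
  case less
  have fin [simp]: "finite (Q `` {x})" if "Q \<subseteq> R" for Q x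
    using that less.prems(1) by (meson finite_Image finite_subset)
  show ?case
  proof (cases "\<exists>u v w. (v, u) \<in> R \<and> (v, w) \<in> R \<and> u \<noteq> w")
    case False
    \<comment> \<open>No vertex has two neighbours, so the additive 1 in the claim already pays for
      the empty orientation.\<close>
    have "card (R `` {v}) \<le> 1" for v
      using False by (subst card_le_Suc0_iff_eq[simplified One_nat_def[symmetric]]) auto
    then show ?thesis by (intro exI[of _ "{}"]) auto
  next
    case True
    then obtain u v w where uvw: "(v, u) \<in> R" "(v, w) \<in> R" "u \<noteq> w" by blast
    have ne: "u \<noteq> v" "v \<noteq> w" and rev: "(u, v) \<in> R" "(w, v) \<in> R"
      using uvw less.prems by (auto simp: irrefl_def dest: symD)
    show ?thesis
    proof (cases "(u, w) \<in> R")
      case True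
      then have "(w, u) \<in> R" using less.prems by (auto dest: symD)
      \<comment> \<open>The triangle is oriented cyclically: each of its vertices loses two
        neighbours in \<open>R'\<close> and regains one out-neighbour, which matches the factor
        2.\<close>
      define C where "C = {(u, v), (v, w), (w, u)}"
      define R' where "R' = R - C - C\<inverse>"
      have "card R' < card R"
        unfolding R'_def C_def using uvw less.prems(1) by (intro psubset_card_mono) auto
      moreover have "finite R'" "sym R'" "irrefl R'"
        using less.prems unfolding R'_def by (auto simp: sym_def irrefl_def)
      ultimately obtain A where A: "A \<subseteq> R'" "A \<inter> A\<inverse> = {}"
        "\<And>x. card (R' `` {x}) \<le> 2 * card (A `` {x}) + 1"
        using less.hyps by meson
have AR: "A \<subseteq> R" "R' \<subseteq> R" using A unfolding R'_def by auto
      have "card (R `` {x}) \<le> 2 * card ((A \<union> C) `` {x}) + 1" for x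
      proof (cases "x \<in> {u, v, w}")
        case False
        then have "R `` {x} = R' `` {x}" "(A \<union> C) `` {x} = A `` {x}"
          unfolding R'_def C_def by auto
        then show ?thesis using A(3)[of x] by simp
      next
        case True
        then consider "x = u" | "x = v" | "x = w" by blast
        \<comment> \<open>\<open>y\<close> is the successor of \<open>x\<close> on the triangle and
          \<open>z\<close> its predecessor.\<close>
        then obtain y z where yz: "(x, y) \<in> C" "R `` {x} \<subseteq> insert y (insert z (R' `` {x}))"
        proof cases
          case 1
          then show thesis by (intro that[of v w]) (auto simp: R'_def C_def)
        next
          case 2
          then show thesis by (intro that[of w u]) (auto simp: R'_def C_def)
        next
          case 3
          then show thesis by (intro that[of u v]) (auto simp: R'_def C_def)
        qed
        have "(x, y) \<notin> A" "A \<union> C \<subseteq> R"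
          using yz(1) A(1) uvw rev \<open>(w, u) \<in> R\<close> unfolding R'_def C_def by auto
        then have "card (A `` {x}) < card ((A \<union> C) `` {x})"
          using yz(1) by (intro psubset_card_mono) auto
        then show ?thesis using A(3)[of x] yz(2) AR(2)
          using card_mono[of "insert y (insert z (R' `` {x}))" "R `` {x}"]
          by (simp add: card_insert_if split: if_splits)
      qed
      moreover have "(A \<union> C) \<inter> (A \<union> C)\<inverse> = {}"
        using A(1,2) uvw(3) ne unfolding R'_def C_def by auto
      moreover have "A \<union> C \<subseteq> R"
        using AR uvw rev \<open>(w, u) \<in> R\<close> unfolding C_def by auto
      ultimately show ?thesis by blast
    next
      case False
      then have nwu: "(w, u) \<notin> R" using less.prems by (auto dest: symD)
      \<comment> \<open>Here \<open>C\<close> holds both directions of the two edges at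
        \<open>v\<close>. Four pairs leave and at most two enter, so the induction applies to
        \<open>R'\<close>.\<close>
      define C where "C = {(u, v), (v, u), (v, w), (w, v)}"
      define R' where "R' = R - C \<union> {(u, w), (w, u)}"
      have "C \<subseteq> R" "card C = 4" "finite C" using uvw rev ne unfolding C_def by auto
      then have "card (R - C) + 4 = card R"
        using less.prems(1) by (metis card_Diff_subset card_mono le_add_diff_inverse2)
      moreover have "card R' \<le> card (R - C) + card {(u, w), (w, u)}"
        unfolding R'_def by (rule card_Un_le)
      moreover have "card {(u, w), (w, u)} \<le> 2"
        using card_length[of "[(u, w), (w, u)]"] by (simp only: list.set list.size)
      ultimately have "card R' < card R" by linarith
      moreover have "finite R'" "sym R'" "irrefl R'"
        using less.prems uvw(3) unfolding R'_def C_def by (auto simp: sym_def irrefl_def)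
      ultimately obtain A where A: "A \<subseteq> R'" "A \<inter> A\<inverse> = {}"
        "\<And>x. card (R' `` {x}) \<le> 2 * card (A `` {x}) + 1"
        using less.hyps by meson
      have finR' [simp]: "finite (Q `` {x})" if "Q \<subseteq> R'" for Q x
        using that \<open>finite R'\<close> by (meson finite_Image finite_subset)
      \<comment> \<open>The ends are named so that \<open>A\<close> uses the new edge from
        \<open>p\<close> to \<open>q\<close> or not at all; \<open>A\<close> need not orient every
        edge. Either way the path from \<open>p\<close> through \<open>v\<close> to \<open>q\<close>
        replaces it.\<close>
      obtain p q where pq: "p = u \<and> q = w \<or> p = w \<and> q = u" "(q, p) \<notin> A"
        using A(2) by blast
      have pqv: "p \<noteq> q" "p \<noteq> v" "q \<noteq> v" "(p, v) \<in> R" "(v, q) \<in> R" "(p, q) \<in> R'" "(q, p) \<in> R'"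
        "(v, q) \<notin> R'" "(v, p) \<notin> R'" "(p, v) \<notin> R'" "(q, v) \<notin> R'"
        "(p, q) \<notin> R" "(q, p) \<notin> R"
        using pq(1) uvw rev ne False nwu unfolding R'_def C_def by auto
      have RR': "R \<subseteq> R' \<union> {(p, v), (v, p), (v, q), (q, v)}" "R' \<subseteq> R \<union> {(p, q), (q, p)}"
        using pq(1) unfolding R'_def C_def by auto
      define A2 where "A2 = A - {(p, q)} \<union> {(p, v), (v, q)}"
      have A2R: "A2 \<subseteq> R" using A(1) RR' pq(2) pqv unfolding A2_def by auto
      have "A2 \<inter> A2\<inverse> = {}" using A(1,2) pqv unfolding A2_def by auto
      moreover have "card (R `` {x}) \<le> 2 * card (A2 `` {x}) + 1" for x
      proof -
        consider "x = v" | "x = p" | "x = q" | "x \<notin> {v, p, q}" by blast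
        then show ?thesis
        proof cases
          case 1
          have "R `` {v} \<subseteq> insert q (insert p (R' `` {v}))" using RR' pqv by auto
          moreover have "card (A `` {v}) < card (A2 `` {v})"
            using A2R A(1) pqv unfolding A2_def by (intro psubset_card_mono) auto
          ultimately show ?thesis using A(3)[of v] 1
            using card_mono[of "insert q (insert p (R' `` {v}))" "R `` {v}"]
            by (simp add: card_insert_if split: if_splits)
        next
          case 2
          \<comment> \<open>Passing from \<open>R'\<close> to \<open>R\<close>, \<open>p\<close>
            trades the neighbour \<open>q\<close> for \<open>v\<close>, and likewise for its
            out-neighbours if \<open>(p, q)\<close> is in \<open>A\<close>; otherwise its out-degree
            does not drop.\<close>
          have "R `` {p} \<subseteq> insert v (R' `` {p} - {q})" using RR' pqv by auto
          then have "card (R `` {p}) \<le> card (insert v (R' `` {p} - {q}))"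
            by (intro card_mono) auto
          also have "\<dots> = card (R' `` {p})"
            using pqv by (intro card_exchange) auto
          finally have "card (R `` {p}) \<le> card (R' `` {p})" .
          moreover have "card (insert v (A `` {p} - {q})) \<le> card (A2 `` {p})"
            using A2R pqv unfolding A2_def by (intro card_mono) auto
          moreover have "card (A `` {p}) \<le> card (insert v (A `` {p} - {q}))"
          proof (cases "(p, q) \<in> A")
            case True
            then show ?thesis
              using A(1) pqv by (intro eq_refl card_exchange[symmetric]) auto
          next
            case False
            then show ?thesis using A(1) by (intro card_mono) auto
          qed
          ultimately show ?thesis using A(3)[of p] 2 by simp
        next
          case 3
          have "R `` {q} \<subseteq> insert v (R' `` {q} - {p})" using RR' pqv by auto
          then have "card (R `` {q}) \<le> card (insert v (R' `` {q} - {p}))"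
            by (intro card_mono) auto
          also have "\<dots> = card (R' `` {q})"
            using pqv by (intro card_exchange) auto
          finally have "card (R `` {q}) \<le> card (R' `` {q})" .
          moreover have "A2 `` {q} = A `` {q}" using pqv unfolding A2_def by auto
          ultimately show ?thesis using A(3)[of q] 3 by simp
        next
          case 4
          then have "R `` {x} \<subseteq> R' `` {x}" "A2 `` {x} = A `` {x}"
            using RR' unfolding A2_def by auto
          then show ?thesis using A(3)[of x] card_mono[of "R' `` {x}" "R `` {x}"] by simp
        qed
      qed
      ultimately show ?thesis using A2R by blast
    qed
  qed
qed

section \<open>Packings and even partitions\<close>

text \<open>Take a packing of largest cardinality: disjointness bounds its size, and a vertex whose
  set missed all chosen ones could be added. The factors \<open>a\<close> and \<open>b\<close>
  express the lower bound \<open>b / a\<close> on set sizes without division.\<close>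

lemma maximal_packing:
  fixes a b :: nat
  assumes "finite V" "\<And>v. v \<in> V \<Longrightarrow> v \<in> N v \<and> N v \<subseteq> V \<and> b \<le> a * card (N v)"
  shows "\<exists>D\<subseteq>V. card D * b \<le> a * card V \<and> (\<forall>v\<in>V. \<exists>x\<in>D. N v \<inter> N x \<noteq> {})"
proof -
  define P where "P D \<longleftrightarrow> D \<subseteq> V \<and> (\<forall>x\<in>D. \<forall>y\<in>D. x \<noteq> y \<longrightarrow> N x \<inter> N y = {})" for D
  have "P {}" by (simp add: P_def)
  moreover have "\<forall>D. P D \<longrightarrow> card D < Suc (card V)"
    using assms(1) by (auto simp: P_def less_Suc_eq_le intro: card_mono)
  ultimately obtain D where D: "P D" and max: "\<And>D'. P D' \<Longrightarrow> card D' \<le> card D"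
    using ex_has_greatest_nat[of P "{}" card "Suc (card V)"] by blast
  have "D \<subseteq> V" "finite D" using D assms(1) finite_subset unfolding P_def by auto
  have "card D * b \<le> (\<Sum>x\<in>D. a * card (N x))"
    using sum_bounded_below[of D b "\<lambda>x. a * card (N x)"] assms(2) \<open>D \<subseteq> V\<close> by auto
  also have "\<dots> = a * card (\<Union>x\<in>D. N x)"
    using D assms \<open>D \<subseteq> V\<close> \<open>finite D\<close> finite_subset[of _ V]
    by (subst card_UN_disjoint) (auto simp: P_def sum_distrib_left)
  also have "\<dots> \<le> a * card V"
    using assms \<open>D \<subseteq> V\<close> by (intro mult_left_mono card_mono) auto
  finally have "card D * b \<le> a * card V" .
  moreover have "\<exists>x\<in>D. N v \<inter> N x \<noteq> {}" if "v \<in> V" for v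
  proof (rule ccontr)
    assume *: "\<not> ?thesis"
    then have "v \<notin> D" using assms(2)[OF that] by auto
    have "P (insert v D)" using D * that unfolding P_def by (auto simp: Int_commute)
    then have "card (insert v D) \<le> card D" by (rule max)
    then show False using \<open>v \<notin> D\<close> \<open>finite D\<close> by simp
  qed
  ultimately show ?thesis using \<open>D \<subseteq> V\<close> by blast
qed

text \<open>Number the elements of \<open>X\<close> and reduce modulo \<open>k\<close>: the numbers
  \<open>m * k + i\<close> with \<open>m < card X div k\<close> all lie below \<open>card X\<close>
  and have residue \<open>i\<close>.\<close>

lemma even_partition:
  assumes "finite X" "0 < k"
  shows "\<exists>f::'b \<Rightarrow> nat. (\<forall>x. f x < k) \<and> (\<forall>i<k. card X div k \<le> card {x \<in> X. f x = i})"
proof -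
  obtain h where h: "bij_betw h X {0..<card X}"
    using ex_bij_betw_finite_nat[OF assms(1)] by blast
  have "card X div k \<le> card {x \<in> X. h x mod k = i}" if "i < k" for i
  proof -
    have "card X div k = card ((\<lambda>m. m * k + i) ` {..<card X div k})"
      using assms(2) by (subst card_image) (auto simp: inj_on_def)
    also have "\<dots> \<le> card (h ` {x \<in> X. h x mod k = i})"
    proof (rule card_mono)
      show "finite (h ` {x \<in> X. h x mod k = i})" using assms(1) by simp
      show "(\<lambda>m. m * k + i) ` {..<card X div k} \<subseteq> h ` {x \<in> X. h x mod k = i}"
      proof
        fix j assume "j \<in> (\<lambda>m. m * k + i) ` {..<card X div k}"
        then obtain m where m: "m < card X div k" "j = m * k + i" by auto
        have "m * k + i < Suc m * k" using that by simp
        also have "\<dots> \<le> card X div k * k" using m(1) by (intro mult_right_mono) auto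
        also have "\<dots> \<le> card X" by simp
        finally have "j \<in> h ` X" using h m(2) by (simp add: bij_betw_def)
        moreover have "j mod k = i" using m(2) that by simp
        ultimately show "j \<in> h ` {x \<in> X. h x mod k = i}" by auto
      qed
    qed
    also have "\<dots> \<le> card {x \<in> X. h x mod k = i}"
      using assms(1) by (intro card_image_le) simp
    finally show ?thesis .
  qed
  then show ?thesis using assms(2) by (intro exI[of _ "\<lambda>x. h x mod k"]) auto
qed

section \<open>Connected subgraphs close to every vertex\<close>

text \<open>Allowing \<open>a = s\<close> makes trivial steps legitimate, so a walk of length at
  most two is handled as exactly two steps.\<close>

lemma connected_graph_extend:
  assumes "connected_graph S T" "S \<subseteq> V" "T \<subseteq> E" "simple_graph V E"
    and "s \<in> S" "a = s \<or> {s, a} \<in> E"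
  shows "\<exists>S' T'. connected_graph S' T' \<and> S \<subseteq> S' \<and> S' \<subseteq> V \<and> T' \<subseteq> E \<and> a \<in> S' \<and>
    card T' \<le> card T + 1"
proof (cases "a = s")
  case True
  then show ?thesis using assms by (intro exI[of _ S] exI[of _ T]) auto
next
  case False
  then have e: "{s, a} \<in> E" using assms(6) by simp
  have "finite T"
    using assms(1) simple_graph_finite_edges unfolding connected_graph_def by blast
  then show ?thesis
    using connected_graph_insert[OF assms(1,5)] False e adjacency_in_vertices[OF assms(4) e] assms
    by (intro exI[of _ "insert a S"] exI[of _ "insert {s, a} T"]) (auto simp: card_insert_if)
qed

text \<open>Reflexive adjacency: \<open>{u. close E v u}\<close> is the closed neighbourhood of
  \<open>v\<close>, and two \<open>close\<close> steps mean distance at most two.\<close>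

definition close :: "'a set set \<Rightarrow> 'a \<Rightarrow> 'a \<Rightarrow> bool" where
  "close E u v \<longleftrightarrow> u = v \<or> {u, v} \<in> E"

lemma close_sym: "close E u v \<Longrightarrow> close E v u"
  by (auto simp: close_def insert_commute)

text \<open>The original \<open>S\<close> stays inside every enlargement, so each \<open>x\<close>
  still costs at most two further edges.\<close>

lemma connected_graph_reach:
  assumes sg: "simple_graph V E" and "finite X"
    and "connected_graph S T" "S \<subseteq> V" "T \<subseteq> E"
    and "\<And>x. x \<in> X \<Longrightarrow> \<exists>s\<in>S. \<exists>a. close E s a \<and> close E a x"
  shows "\<exists>S' T'. connected_graph S' T' \<and> S \<subseteq> S' \<and> X \<subseteq> S' \<and> S' \<subseteq> V \<and> T' \<subseteq> E \<and>
    card T' \<le> card T + 2 * card X"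
  using assms(2,6)
proof (induction X rule: finite_induct)
  case empty
  then show ?case using assms by auto
next
  case (insert x X)
  then obtain S1 T1 where 1: "connected_graph S1 T1" "S \<subseteq> S1" "X \<subseteq> S1" "S1 \<subseteq> V" "T1 \<subseteq> E"
    "card T1 \<le> card T + 2 * card X" by auto
  obtain s a where sa: "s \<in> S" "close E s a" "close E a x" using insert.prems by blast
  obtain S2 T2 where 2: "connected_graph S2 T2" "S1 \<subseteq> S2" "S2 \<subseteq> V" "T2 \<subseteq> E" "a \<in> S2"
    "card T2 \<le> card T1 + 1"
    using connected_graph_extend[OF 1(1,4,5) sg, of s a] sa 1(2) unfolding close_def by blast
  obtain S3 T3 where 3: "connected_graph S3 T3" "S2 \<subseteq> S3" "S3 \<subseteq> V" "T3 \<subseteq> E" "x \<in> S3"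
    "card T3 \<le> card T2 + 1"
    using connected_graph_extend[OF 2(1,3,4) sg, of a x] sa 2 unfolding close_def by blast
  have "card T3 \<le> card T + 2 * card (insert x X)" using 1 2 3 insert.hyps by simp
  then show ?case using 1 2 3
    by (intro exI[of _ S3] exI[of _ T3]) auto
qed

text \<open>Collect as many centres as possible with disjoint closed neighbourhoods. If some vertex
  is farther than two from the subgraph, there is one at distance three, which becomes a new centre
  for at most three edges.\<close>

lemma connected_two_step_dominating:
  assumes conn: "connected_graph V E" and deg: "\<And>v. v \<in> V \<Longrightarrow> q \<le> card {u. close E v u}"
  shows "\<exists>S T. connected_graph S T \<and> S \<subseteq> V \<and> T \<subseteq> E \<and> (card T + 3) * q \<le> 3 * card V \<and>
    (\<forall>v\<in>V. \<exists>s\<in>S. \<exists>a. close E s a \<and> close E a v)"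
proof -
  have sg: "simple_graph V E" and "finite V"
    using conn unfolding connected_graph_def simple_graph_def by auto
  have closeV: "close E u v \<Longrightarrow> u \<in> V \<Longrightarrow> v \<in> V" for u v
    using adjacency_in_vertices[OF sg] by (auto simp: close_def)
  \<comment> \<open>The summand 3 records that the first centre costs no edge; it survives as the
    \<open>+ 3\<close> of the conclusion.\<close>
  define P where "P C \<longleftrightarrow> (\<forall>x\<in>C. \<forall>y\<in>C. x \<noteq> y \<longrightarrow> {u. close E x u} \<inter> {u. close E y u} = {}) \<and>
    (\<exists>S T. connected_graph S T \<and> C \<subseteq> S \<and> S \<subseteq> V \<and> T \<subseteq> E \<and> card T + 3 \<le> 3 * card C)" for C
  obtain r where "r \<in> V" using conn unfolding connected_graph_def by auto
  have "connected_graph {r} {}" by (simp add: connected_graph_def simple_graph_def)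
  then have "P {r}" unfolding P_def using \<open>r \<in> V\<close>
    by (intro conjI exI[of _ "{r}"] exI[of _ "{}"]) auto
  moreover have "\<forall>C. P C \<longrightarrow> card C < Suc (card V)"
    using \<open>finite V\<close> by (auto simp: P_def less_Suc_eq_le intro!: card_mono)
  ultimately obtain C where C: "P C" and max: "\<And>C'. P C' \<Longrightarrow> card C' \<le> card C"
    using ex_has_greatest_nat[of P "{r}" card "Suc (card V)"] by blast
  then obtain S T where ST: "connected_graph S T" "C \<subseteq> S" "S \<subseteq> V" "T \<subseteq> E"
    "card T + 3 \<le> 3 * card C" unfolding P_def by blast
  have "finite C" using ST(2,3) \<open>finite V\<close> by (meson finite_subset)
  have "card C * q \<le> (\<Sum>x\<in>C. card {u. close E x u})"
    using sum_bounded_below[of C q "\<lambda>x. card {u. close E x u}"] deg ST by auto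
  also have "\<dots> = card (\<Union>x\<in>C. {u. close E x u})"
  proof (rule card_UN_disjoint[symmetric])
    show "\<forall>x\<in>C. finite {u. close E x u}"
      using ST closeV by (auto intro!: finite_subset[OF _ \<open>finite V\<close>])
  qed (use \<open>finite C\<close> C in \<open>auto simp: P_def\<close>)
  also have "\<dots> \<le> card V"
    using ST closeV by (intro card_mono[OF \<open>finite V\<close>]) auto
  finally have "(3 * card C) * q \<le> 3 * card V" by simp
  then have "(card T + 3) * q \<le> 3 * card V"
    using mult_right_mono[OF ST(5), of q] by linarith
  moreover have "\<exists>s\<in>S. \<exists>a. close E s a \<and> close E a v" if "v \<in> V" for v
  proof (rule ccontr)
    define B where "B = {x. \<exists>s\<in>S. \<exists>a. close E s a \<and> close E a x}"
    assume "\<not> ?thesis"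
    then have "v \<notin> B" unfolding B_def by blast
    have "S \<subseteq> B" unfolding B_def close_def by blast
    obtain s0 where "s0 \<in> S" using ST(1) unfolding connected_graph_def by blast
    then have "(s0, v) \<in> (adjacency E)\<^sup>*" "s0 \<in> B"
      using conn \<open>v \<in> V\<close> ST(3) \<open>S \<subseteq> B\<close> unfolding connected_graph_def by auto
    \<comment> \<open>A walk from \<open>s0\<close> to \<open>v\<close> must leave the ball
      \<open>B\<close> of radius two, and the first vertex outside is at distance three.\<close>
    have "\<exists>x y. x \<in> B \<and> y \<notin> B \<and> {x, y} \<in> E"
    proof (rule ccontr)
      assume *: "\<not> ?thesis"
      have "z \<in> B" if "(s0, z) \<in> (adjacency E)\<^sup>*" for z
        using that by (induction rule: rtrancl_induct) (use * \<open>s0 \<in> B\<close> in auto)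
      then show False using \<open>(s0, v) \<in> _\<close> \<open>v \<notin> B\<close> by blast
    qed
    then obtain x y where xy: "x \<in> B" "y \<notin> B" "{x, y} \<in> E" by blast
    then obtain s a where sa: "s \<in> S" "close E s a" "close E a x" unfolding B_def by blast
    obtain S1 T1 where 1: "connected_graph S1 T1" "S \<subseteq> S1" "S1 \<subseteq> V" "T1 \<subseteq> E" "a \<in> S1"
      "card T1 \<le> card T + 1"
      using connected_graph_extend[OF ST(1,3,4) sg, of s a] sa unfolding close_def by blast
    obtain S2 T2 where 2: "connected_graph S2 T2" "S1 \<subseteq> S2" "S2 \<subseteq> V" "T2 \<subseteq> E" "x \<in> S2"
      "card T2 \<le> card T1 + 1"
      using connected_graph_extend[OF 1(1,3,4) sg, of a x] sa 1 unfolding close_def by blast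
    obtain S3 T3 where 3: "connected_graph S3 T3" "S2 \<subseteq> S3" "S3 \<subseteq> V" "T3 \<subseteq> E" "y \<in> S3"
      "card T3 \<le> card T2 + 1"
      using connected_graph_extend[OF 2(1,3,4) sg, of x y] xy 2 by blast
    have "y \<notin> C" using xy(2) ST(2) \<open>S \<subseteq> B\<close> by blast
    \<comment> \<open>A common member of the two closed neighbourhoods would put \<open>y\<close>
      within two steps of \<open>c\<close>, which lies in \<open>S\<close>.\<close>
    have disj: "{u. close E y u} \<inter> {u. close E c u} = {}" if "c \<in> C" for c
      using xy(2) that ST(2) close_sym[of E y] unfolding B_def by blast
    have "card T3 + 3 \<le> 3 * card (insert y C)"
      using 1 2 3 ST(5) \<open>y \<notin> C\<close> \<open>finite C\<close> by simp
    then have "\<exists>S T. connected_graph S T \<and> insert y C \<subseteq> S \<and> S \<subseteq> V \<and> T \<subseteq> E \<and>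
        card T + 3 \<le> 3 * card (insert y C)"
      using 1 2 3 ST(2) by (intro exI[of _ S3] exI[of _ T3]) auto
    then have "P (insert y C)" using C disj unfolding P_def by (auto simp: Int_commute)
    then have "card (insert y C) \<le> card C" by (rule max)
    then show False using \<open>y \<notin> C\<close> \<open>finite C\<close> by simp
  qed
  ultimately show ?thesis using ST by blast
qed

section \<open>The colouring and its rainbow trees\<close>

text \<open>An edge has at most one orientation in \<open>A\<close>, so choice recovers it. Sets
  without one get an arbitrary value of \<open>f\<close>, still below \<open>m\<close> because
  \<open>f\<close> is bounded everywhere.\<close>

lemma edge_function_of_orientation:
  assumes "A \<inter> A\<inverse> = {}" "\<And>p. f p < (m::nat)"
  shows "\<exists>c. (\<forall>e. c e < m) \<and> (\<forall>u v. (u, v) \<in> A \<longrightarrow> c {u, v} = f (u, v))"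
proof (intro exI conjI allI impI)
  let ?c = "\<lambda>e. f (SOME p. p \<in> A \<and> e = {fst p, snd p})"
  show "?c e < m" for e by (rule assms(2))
  fix u v assume "(u, v) \<in> A"
  then have "(SOME p. p \<in> A \<and> {u, v} = {fst p, snd p}) = (u, v)"
    using assms(1) by (intro some_equality) (auto simp: doubleton_eq_iff)
  then show "?c {u, v} = f (u, v)" by simp
qed

text \<open>In \<open>dom\<close>, \<open>y\<close> is a common point of the closed
  class-\<open>i\<close> out-neighbourhoods of \<open>v\<close> and \<open>x\<close>. Both edges of
  the leg point towards \<open>y\<close>, so their tails tell them apart.\<close>

lemma rainbow_index_le:
  assumes sg: "simple_graph V E"
    and ST: "connected_graph S T" "S \<subseteq> V" "T \<subseteq> E"
    and A: "A \<subseteq> adjacency E" "A \<inter> A\<inverse> = {}"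
    and cls: "\<And>p. cls p < k"
    and D: "\<And>i. i < k \<Longrightarrow> D i \<subseteq> S"
    and dom: "\<And>i v. i < k \<Longrightarrow> v \<in> V \<Longrightarrow> \<exists>x\<in>D i. \<exists>y.
      (y = v \<or> (v, y) \<in> A \<and> cls (v, y) = i) \<and> (y = x \<or> (x, y) \<in> A \<and> cls (x, y) = i)"
  shows "rainbow_index k V E \<le> card T + 2 * k"
proof -
  have "finite T"
    using ST(1) simple_graph_finite_edges unfolding connected_graph_def by blast
  have TS: "e \<subseteq> S" if "e \<in> T" for e
    using ST(1) that unfolding connected_graph_def simple_graph_def by blast
  \<comment> \<open>Class \<open>i\<close> owns the colours \<open>2 * i\<close>, for tails in
    \<open>D i\<close>, and \<open>2 * i + 1\<close>, for all other tails.\<close>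
  define f where "f p = 2 * cls p + (if fst p \<in> D (cls p) then 0 else 1)" for p
  have "f p < 2 * k" for p using cls[of p] unfolding f_def by simp
  then obtain c0 where c0: "\<And>e. c0 e < 2 * k" "\<And>u v. (u, v) \<in> A \<Longrightarrow> c0 {u, v} = f (u, v)"
    using edge_function_of_orientation[OF A(2), of f "2 * k"] by blast
  obtain g :: "'a set \<Rightarrow> nat" where g: "inj_on g T"
    using finite_imp_inj_to_nat_seg[OF \<open>finite T\<close>] by blast
  \<comment> \<open>The shift by \<open>2 * k\<close> separates the colours on \<open>T\<close> from
    all class colours.\<close>
  define c where "c e = (if e \<in> T then 2 * k + g e else c0 e)" for e
  have "c ` E \<subseteq> c ` T \<union> {..<2 * k}" using c0(1) unfolding c_def by auto
  then have "card (c ` E) \<le> card (c ` T \<union> {..<2 * k})"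
    using \<open>finite T\<close> by (intro card_mono) auto
  also have "\<dots> \<le> card (c ` T) + 2 * k" using card_Un_le[of "c ` T" "{..<2 * k}"] by simp
  also have "\<dots> \<le> card T + 2 * k" using \<open>finite T\<close> by (simp add: card_image_le)
  finally have "card (c ` E) \<le> card T + 2 * k" .
  moreover have "k_rainbow_coloring k V E c"
    unfolding k_rainbow_coloring_def
  proof (intro allI impI)
    fix U assume U: "U \<subseteq> V \<and> card U = k"
    then have "finite U" using sg finite_subset unfolding simple_graph_def by blast
    then obtain h where h: "bij_betw h {0..<k} U"
      using ex_bij_betw_nat_finite[of U] U by blast
    \<comment> \<open>Legs are attached in order of increasing colour, so an upper bound
      \<open>j\<close> on the colours outside \<open>T\<close> is enough to see that the next colour
      is fresh.\<close>
    define Q where "Q W F j \<longleftrightarrow> connected_graph W F \<and> S \<subseteq> W \<and> W \<subseteq> V \<and> T \<subseteq> F \<and> F \<subseteq> E \<and>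
      inj_on c F \<and> (\<forall>e\<in>F - T. c e < j)" for W F j
    have add: "Q (insert y W) (insert {x, y} F) j'"
      if "Q W F j" "x \<in> W" "{x, y} \<in> E" "{x, y} \<notin> T" "j \<le> c0 {x, y}" "c0 {x, y} < j'" for W F j j' x y
    proof -
      have ceq: "c {x, y} = c0 {x, y}" using that unfolding c_def by simp
      moreover have "c {x, y} \<notin> c ` F"
      proof
        assume "c {x, y} \<in> c ` F"
        then obtain e where "e \<in> F" "c {x, y} = c e" by auto
        show False
        proof (cases "e \<in> T")
          case True
          then show ?thesis using \<open>c {x, y} = c e\<close> ceq c0(1)[of "{x, y}"] by (simp add: c_def)
        next
          case False
          then have "c e < j" using that(1) \<open>e \<in> F\<close> unfolding Q_def by blast
          then show ?thesis using \<open>c {x, y} = c e\<close> ceq that(5) by simp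
        qed
      qed
      moreover have "c e < j'" if "e \<in> F - T" for e
        using \<open>Q W F j\<close> that \<open>j \<le> c0 {x, y}\<close> \<open>c0 {x, y} < j'\<close> unfolding Q_def
        by (meson le_less_trans less_trans less_le_trans)
      ultimately show ?thesis
        using that connected_graph_insert[of W F x y] adjacency_in_vertices[OF sg that(3)]
        unfolding Q_def by auto
    qed
    have Qmono: "Q W F j \<Longrightarrow> j \<le> j' \<Longrightarrow> Q W F j'" for W F j j'
      unfolding Q_def by (meson less_le_trans)
    \<comment> \<open>The vertex \<open>h j\<close> is attached through class \<open>j\<close>,
      whose two colours are exactly those between \<open>2 * j\<close> and
      \<open>2 * Suc j\<close>.\<close>
    have "\<exists>W F. Q W F (2 * j) \<and> h ` {0..<j} \<subseteq> W" if "j \<le> k" for j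
      using that
    proof (induction j)
      case 0
      have "inj_on c T" using g unfolding c_def inj_on_def by auto
      then show ?case using ST by (intro exI[of _ S] exI[of _ T]) (auto simp: Q_def)
    next
      case (Suc j)
      then obtain W F where WF: "Q W F (2 * j)" "h ` {0..<j} \<subseteq> W" by auto
      define v where "v = h j"
      have "\<exists>W' F'. Q W' F' (2 * Suc j) \<and> W \<subseteq> W' \<and> v \<in> W'"
      proof (cases "v \<in> S")
        case True
        then show ?thesis using Qmono[OF WF(1), of "2 * Suc j"] WF(1)
          by (intro exI[of _ W] exI[of _ F]) (auto simp: Q_def)
      next
        case False
        have "j < k" using Suc.prems by simp
        then have "v \<in> V" using h U unfolding v_def bij_betw_def by auto
        obtain x y where xy: "x \<in> D j"
          "y = v \<or> (v, y) \<in> A \<and> cls (v, y) = j" "y = x \<or> (x, y) \<in> A \<and> cls (x, y) = j"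
          using dom[OF \<open>j < k\<close> \<open>v \<in> V\<close>] by blast
        have "x \<in> S" "v \<notin> D j" "x \<in> W" using xy(1) D \<open>j < k\<close> False WF(1) by (auto simp: Q_def)
        have last: "c0 {x, y} = 2 * j" "{x, y} \<in> E" if "y \<noteq> x"
          using that xy A(1) c0(2)[of x y] by (auto simp: f_def)
        have first: "c0 {y, v} = 2 * j + 1" "{y, v} \<in> E" "{y, v} \<notin> T" if "y \<noteq> v"
          using that xy A(1) c0(2)[of v y] \<open>v \<notin> D j\<close> False TS[of "{y, v}"]
          by (auto simp: f_def insert_commute)
        show ?thesis
        \<comment> \<open>If \<open>y\<close> is in \<open>S\<close>, the single edge to
          \<open>v\<close> suffices, and \<open>{x, y}\<close> might belong to \<open>T\<close>.
          Otherwise \<open>{x, y}\<close> is outside \<open>T\<close> and is added first, having the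
          smaller colour.\<close>
        proof (cases "y \<in> S")
          case True
          then have "y \<in> W" "y \<noteq> v" using WF(1) False by (auto simp: Q_def)
          then have "Q (insert v W) (insert {y, v} F) (2 * Suc j)"
            using first by (intro add[OF WF(1)]) auto
          then show ?thesis by blast
        next
          case yS: False
          then have "y \<noteq> x" "{x, y} \<notin> T" using \<open>x \<in> S\<close> TS[of "{x, y}"] by auto
          then have 1: "Q (insert y W) (insert {x, y} F) (2 * j + 1)"
            using last \<open>x \<in> W\<close> by (intro add[OF WF(1)]) auto
          show ?thesis
          proof (cases "y = v")
            case True
            then show ?thesis using Qmono[OF 1, of "2 * Suc j"] by auto
          next
            case False
            then have "Q (insert v (insert y W)) (insert {y, v} (insert {x, y} F)) (2 * Suc j)"
              using first by (intro add[OF 1]) auto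
            then show ?thesis by blast
          qed
        qed
      qed
      then show ?case using WF(2) unfolding v_def
        by (metis (no_types, lifting) atLeast0_lessThan_Suc image_insert insert_subset order_trans)
    qed
    then obtain W F where WF: "Q W F (2 * k)" "h ` {0..<k} \<subseteq> W" by blast
    then obtain F' where F': "F' \<subseteq> F" "is_tree W F'"
      using connected_graph_has_spanning_tree[of W F] unfolding Q_def by blast
    have "rainbow_tree_in V E c W F'"
      using WF(1) F' inj_on_subset[of c F F'] unfolding rainbow_tree_in_def Q_def by blast
    moreover have "U \<subseteq> W" using WF(2) h by (simp add: bij_betw_def)
    ultimately show "\<exists>W F. rainbow_tree_in V E c W F \<and> U \<subseteq> W" by blast
  qed
  then have "rainbow_index k V E \<le> card (c ` E)"
    unfolding rainbow_index_def by (intro Least_le) blast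
  ultimately show ?thesis by simp
qed

section \<open>Degrees within the classes and the bound in natural numbers\<close>

lemma vertex_degree_eq:
  assumes "simple_graph V E"
  shows "vertex_degree E v = card (adjacency E `` {v})"
proof -
  have "{e \<in> E. v \<in> e} = (\<lambda>w. {v, w}) ` (adjacency E `` {v})"
  proof (intro equalityI subsetI)
    fix e assume e: "e \<in> {e \<in> E. v \<in> e}"
    then have "card e = 2" using assms unfolding simple_graph_def by blast
    then obtain w where "e = {v, w}" using e by (auto simp: card_2_iff insert_commute)
    then show "e \<in> (\<lambda>w. {v, w}) ` (adjacency E `` {v})" using e by auto
  qed auto
  moreover have "inj_on (\<lambda>w. {v, w}) (adjacency E `` {v})"
    by (auto simp: inj_on_def doubleton_eq_iff)
  ultimately show ?thesis unfolding vertex_degree_def by (simp add: card_image)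
qed

text \<open>With out-degree \<open>a\<close>, the degree plus one is at most
  \<open>2 * (a + 1)\<close>, and \<open>a < k * (a div k + 1)\<close>. Counting \<open>v\<close>
  itself supplies the 1 that absorbs the rounding.\<close>

lemma balanced_edge_classes:
  assumes sg: "simple_graph V E" and "0 < k"
  shows "\<exists>A cls. A \<subseteq> adjacency E \<and> A \<inter> A\<inverse> = {} \<and> (\<forall>p. cls p < k) \<and>
    (\<forall>i<k. \<forall>v. vertex_degree E v + 1 \<le> 2 * k * card (insert v {y. (v, y) \<in> A \<and> cls (v, y) = i}))"
proof -
  have "finite V" using sg unfolding simple_graph_def by blast
  have "adjacency E \<subseteq> V \<times> V" using adjacency_in_vertices[OF sg] by auto
  then have fin: "finite (adjacency E)" by (rule finite_subset) (simp add: \<open>finite V\<close>)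
  have "irrefl (adjacency E)" using adjacency_in_vertices(3)[OF sg] by (force simp: irrefl_def)
  then obtain A where A: "A \<subseteq> adjacency E" "A \<inter> A\<inverse> = {}"
    "\<And>v. card (adjacency E `` {v}) \<le> 2 * card (A `` {v}) + 1"
    using balanced_orientation[OF fin sym_adjacency] by blast
  have finA: "finite (A `` {v})" for v using A(1) fin by (meson finite_Image finite_subset)
  \<comment> \<open>Out-edges are split separately at each tail; since \<open>A\<close> is
    antisymmetric, each oriented edge gets its class from one tail only.\<close>
  have "\<forall>v. \<exists>f. (\<forall>x. f x < k) \<and> (\<forall>i<k. card (A `` {v}) div k \<le> card {x \<in> A `` {v}. f x = i})"
    using even_partition[OF finA \<open>0 < k\<close>] by blast
  then obtain f where f: "\<And>v x. f v x < k"
    "\<And>v i. i < k \<Longrightarrow> card (A `` {v}) div k \<le> card {x \<in> A `` {v}. f v x = i}"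
    by metis
  have "vertex_degree E v + 1 \<le> 2 * k * card (insert v {y. (v, y) \<in> A \<and> f v y = i})"
    if "i < k" for i v
  proof -
    let ?Y = "{x \<in> A `` {v}. f v x = i}"
    have "v \<notin> ?Y" using A(1) simple_graph_no_loop[OF sg, of v] by blast
    moreover have "finite ?Y" using finA[of v] by (rule rev_finite_subset) blast
    ultimately have "card (insert v ?Y) = Suc (card ?Y)" by (rule card_insert_disjoint[rotated])
    then have "card (A `` {v}) div k < card (insert v ?Y)" using f(2)[OF that, of v] by simp
    then have "card (A `` {v}) < k * card (insert v ?Y)"
      using \<open>0 < k\<close> by (simp add: div_less_iff_less_mult mult.commute)
    then show ?thesis using A(3)[of v] by (simp add: vertex_degree_eq[OF sg])
  qed
  then show ?thesis using A f(1)
    by (intro exI[of _ A] exI[of _ "\<lambda>(v, y). f v y"]) auto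
qed

text \<open>Here \<open>m\<close> counts the edges of the enlarged subgraph: the dominating part
  contributes the 3, and \<open>k\<close> packings at two edges per member contribute
  \<open>2 * k * (2 * k)\<close>.\<close>

lemma rainbow_index_bound:
  assumes conn: "connected_graph V E" and "0 < k"
    and deg: "\<And>v. v \<in> V \<Longrightarrow> \<delta> \<le> vertex_degree E v"
  shows "\<exists>m. rainbow_index k V E \<le> m + 2 * k \<and> (m + 3) * (\<delta> + 1) \<le> (3 + 4 * k ^ 2) * card V"
proof -
  have sg: "simple_graph V E" and "finite V"
    using conn unfolding connected_graph_def simple_graph_def by auto
  have closed: "vertex_degree E v + 1 = card {u. close E v u}" for v
  proof -
    have "{u. close E v u} = insert v (adjacency E `` {v})" by (auto simp: close_def)
    moreover have "finite (adjacency E `` {v})"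
      using adjacency_in_vertices[OF sg] by (auto intro!: finite_subset[OF _ \<open>finite V\<close>])
    moreover have "v \<notin> adjacency E `` {v}" using simple_graph_no_loop[OF sg, of v] by blast
    ultimately show ?thesis by (simp add: vertex_degree_eq[OF sg])
  qed
  have "\<delta> + 1 \<le> card {u. close E v u}" if "v \<in> V" for v
    using deg[OF that] closed[of v] by simp
  then obtain S T where ST: "connected_graph S T" "S \<subseteq> V" "T \<subseteq> E"
    "(card T + 3) * (\<delta> + 1) \<le> 3 * card V"
    "\<And>v. v \<in> V \<Longrightarrow> \<exists>s\<in>S. \<exists>a. close E s a \<and> close E a v"
    using connected_two_step_dominating[OF conn, of "\<delta> + 1"] by blast
  obtain A cls where A: "A \<subseteq> adjacency E" "A \<inter> A\<inverse> = {}" and cls: "\<And>p. cls p < k"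
    and cdeg: "\<And>i v. i < k \<Longrightarrow>
      vertex_degree E v + 1 \<le> 2 * k * card (insert v {y. (v, y) \<in> A \<and> cls (v, y) = i})"
    using balanced_edge_classes[OF sg \<open>0 < k\<close>] by blast
  define N where "N i v = insert v {y. (v, y) \<in> A \<and> cls (v, y) = i}" for i v
  have "\<exists>D\<subseteq>V. card D * (\<delta> + 1) \<le> 2 * k * card V \<and> (\<forall>v\<in>V. \<exists>x\<in>D. N i v \<inter> N i x \<noteq> {})"
    if "i < k" for i
  proof (rule maximal_packing[OF \<open>finite V\<close>])
    fix v assume "v \<in> V"
    moreover have "N i v \<subseteq> V"
      using A(1) adjacency_in_vertices[OF sg] \<open>v \<in> V\<close> by (fastforce simp: N_def)
    moreover have "\<delta> + 1 \<le> 2 * k * card (N i v)"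
      using cdeg[OF that, of v] deg[OF \<open>v \<in> V\<close>] unfolding N_def by linarith
    ultimately show "v \<in> N i v \<and> N i v \<subseteq> V \<and> \<delta> + 1 \<le> 2 * k * card (N i v)"
      by (simp add: N_def)
  qed
  then obtain D where D: "\<And>i. i < k \<Longrightarrow> D i \<subseteq> V"
    "\<And>i. i < k \<Longrightarrow> card (D i) * (\<delta> + 1) \<le> 2 * k * card V"
    "\<And>i v. i < k \<Longrightarrow> v \<in> V \<Longrightarrow> \<exists>x\<in>D i. N i v \<inter> N i x \<noteq> {}"
    by metis
  define X where "X = (\<Union>i<k. D i)"
  have "X \<subseteq> V" using D(1) unfolding X_def by auto
  then have "finite X" using \<open>finite V\<close> by (meson finite_subset)
  obtain S' T' where ST': "connected_graph S' T'" "S \<subseteq> S'" "X \<subseteq> S'" "S' \<subseteq> V" "T' \<subseteq> E"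
    "card T' \<le> card T + 2 * card X"
    using connected_graph_reach[OF sg \<open>finite X\<close> ST(1-3)] ST(5) \<open>X \<subseteq> V\<close> by blast
  have "card X \<le> (\<Sum>i<k. card (D i))" unfolding X_def by (rule card_UN_le) simp
  then have "card X * (\<delta> + 1) \<le> (\<Sum>i<k. card (D i)) * (\<delta> + 1)" by (rule mult_right_mono) simp
  also have "\<dots> = (\<Sum>i<k. card (D i) * (\<delta> + 1))" by (rule sum_distrib_right)
  also have "\<dots> \<le> k * (2 * k * card V)"
    using sum_bounded_above[of "{..<k}" "\<lambda>i. card (D i) * (\<delta> + 1)" "2 * k * card V"] D(2) by simp
  finally have X: "card X * (\<delta> + 1) \<le> 2 * k ^ 2 * card V" by (simp add: power2_eq_square ac_simps)
  have "(card T' + 3) * (\<delta> + 1) \<le> (card T + 3) * (\<delta> + 1) + 2 * (card X * (\<delta> + 1))"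
    using mult_right_mono[OF ST'(6), of "\<delta> + 1"] by (simp add: algebra_simps)
  also have "\<dots> \<le> (3 + 4 * k ^ 2) * card V" using ST(4) X by (simp add: algebra_simps)
  finally have "(card T' + 3) * (\<delta> + 1) \<le> (3 + 4 * k ^ 2) * card V" .
  moreover have "rainbow_index k V E \<le> card T' + 2 * k"
  proof (rule rainbow_index_le[OF sg ST'(1,4,5) A cls, where D = D])
    show "D i \<subseteq> S'" if "i < k" for i using that ST'(3) unfolding X_def by blast
    show "\<exists>x\<in>D i. \<exists>y. (y = v \<or> (v, y) \<in> A \<and> cls (v, y) = i) \<and>
        (y = x \<or> (x, y) \<in> A \<and> cls (x, y) = i)" if "i < k" "v \<in> V" for i v
      using D(3)[OF that] unfolding N_def by blast
  qed
  ultimately show ?thesis by blast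
qed

section \<open>Comparison with the asserted bound\<close>

theorem theorem3p8:
  fixes V :: "'a set" and E :: "'a set set" and n \<delta> k t :: nat
  assumes "connected_graph V E"
    and "n = card V"
    and "\<delta> = min_degree V E"
    and "2 \<le> k" and "k \<le> n"
    and "2 ^ t \<le> k" and "k < 2 ^ (t + 1)"
    and "0 < real \<delta> - 2 ^ (t + 1) + 2"
  shows "real (rainbow_index k V E)
    < 10 * real n * real k * 2 ^ t / (real \<delta> - 2 ^ (t + 1) + 2) - real k - 2"
proof -
  have sg: "simple_graph V E" and "finite V" "V \<noteq> {}"
    using assms(1) unfolding connected_graph_def simple_graph_def by auto
  have deg: "\<delta> \<le> vertex_degree E v" if "v \<in> V" for v
    unfolding assms(3) min_degree_def using \<open>finite V\<close> that by (intro Min_le) auto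
  obtain v where "v \<in> V" using \<open>V \<noteq> {}\<close> by blast
  \<comment> \<open>A vertex has fewer than \<open>n\<close> neighbours; this yields
    \<open>1 \<le> x\<close> below, which lets multiples of \<open>x\<close> absorb
    constants.\<close>
  have "adjacency E `` {v} \<subset> V"
    using adjacency_in_vertices(2)[OF sg, of v] simple_graph_no_loop[OF sg, of v] \<open>v \<in> V\<close> by auto
  then have "card (adjacency E `` {v}) < card V" by (rule psubset_card_mono[OF \<open>finite V\<close>])
  then have "\<delta> + 1 \<le> n"
    using deg[OF \<open>v \<in> V\<close>] by (simp add: vertex_degree_eq[OF sg] assms(2))
  have "\<exists>m. rainbow_index k V E \<le> m + 2 * k \<and> (m + 3) * (\<delta> + 1) \<le> (3 + 4 * k ^ 2) * card V"
    by (rule rainbow_index_bound) (use assms(1,4) deg in auto)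
  then obtain m where m: "rainbow_index k V E \<le> m + 2 * k"
    "(m + 3) * (\<delta> + 1) \<le> (3 + 4 * k ^ 2) * n"
    unfolding assms(2) by blast
  define d where "d = real \<delta> + 1"
  define D where "D = real \<delta> - 2 ^ (t + 1) + 2"
  define x where "x = real n / d"
  have "1 \<le> x" "0 < d" using \<open>\<delta> + 1 \<le> n\<close> unfolding x_def d_def by auto
  \<comment> \<open>Integrality improves \<open>k < 2 ^ (t + 1)\<close> by one, giving the factor
    \<open>k + 1\<close> in the lower estimate of the target.\<close>
  have "Suc k \<le> 2 ^ (t + 1)" using assms(7) by simp
  then have k2: "real (Suc k) \<le> 2 * 2 ^ t"
    by (metis (mono_tags) of_nat_le_iff of_nat_numeral of_nat_power power_Suc Suc_eq_plus1)
  have "0 < D" "D \<le> d" using assms(4,8) k2 unfolding D_def d_def by auto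
  have "5 * real k * real (Suc k) * x \<le> 5 * real k * (2 * 2 ^ t) * (real n / D)"
    unfolding x_def using k2 \<open>0 < D\<close> \<open>D \<le> d\<close> by (intro mult_mono divide_left_mono) auto
  then have "5 * real k * (real k + 1) * x \<le> 10 * real n * real k * 2 ^ t / D"
    by (simp add: algebra_simps)
  moreover have "real m + 3 \<le> (3 + 4 * real k ^ 2) * x"
  proof -
    have "real ((m + 3) * (\<delta> + 1)) \<le> real ((3 + 4 * k ^ 2) * n)" using m(2) of_nat_mono by blast
    then show ?thesis using \<open>0 < d\<close> unfolding x_def d_def by (simp add: field_simps)
  qed
  \<comment> \<open>The right factor is \<open>5 * k * (k + 1)\<close> minus
    \<open>3 + 4 * k ^ 2\<close>. The left side collects \<open>2 * k\<close> for the legs and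
    \<open>k + 2\<close> from the claim, less the 3 in \<open>m + 3\<close>.\<close>
  moreover have "3 * real k - 1 < (real k ^ 2 + 5 * real k - 3) * x"
  proof -
    have "4 \<le> real k ^ 2" using assms(4) power_mono[of 2 "real k" 2] by simp
    then have "3 * real k - 1 < real k ^ 2 + 5 * real k - 3"
      "0 \<le> real k ^ 2 + 5 * k - 3" using assms(4) by auto
    then show ?thesis
      using mult_left_mono[OF \<open>1 \<le> x\<close>, of "real k ^ 2 + 5 * k - 3"] by simp
  qed
  ultimately have "real m + 2 * real k < 10 * real n * real k * 2 ^ t / D - real k - 2"
    by (simp add: algebra_simps power2_eq_square)
  moreover have "real (rainbow_index k V E) \<le> real m + 2 * real k" using m(1) by linarith
  ultimately show ?thesis unfolding D_def by simp
qed

end
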